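(* Let $k,\ell\in\mathcal{K}$. Let $\{\mathcal{X}^t\}_{t\in\mathcal{T}}$ be a disjunction; let $\{v^t\}_{t\in\mathcal{T}}$ be a Farkas certificate induced by (IP-$k$) and $\{\mathcal{X}^t\}_{t\in\mathcal{T}}$; and let $\{\mathcal{A}^t\}_{t\in\mathcal{T}}$ be bases such that $\mathcal{A}^t$ determines $v^t$ for all $t\in\mathcal{T}$. If there exists $t\in\mathcal{T}$ such that $\mathcal{A}^t$ is feasible for $\mathcal{Q}^{\ell t}$ and $v^t\neq 0$, then every pair $(\alpha,\bar\beta)$ that can be returned by the Strong PDI Generator (defined in the context) on input $k,\ell,\{\mathcal{X}^t\}_{t\in\mathcal{T}},\{v^t\}_{t\in\mathcal{T}},\{\mathcal{A}^t\}_{t\in\mathcal{T}}$ supports $\operatorname{cl}\operatorname{conv}\left(\bigcup_{t\in\mathcal{T}}\mathcal{Q}^{\ell t}\right)$.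
   Context: Setting. $\mathcal{K}$ indexes a family of mixed-integer linear programs with the same $n$ variables, the same number $m$ of constraints and the same index set $\mathcal{I}\subseteq[n]=\{1,\dots,n\}$ of integer variables. Instance (IP-$k$) is $\min\{c^k x : x\in \mathcal{P}_I^k\}$, where $\mathcal{P}^k=\{x\in\mathbb{R}^n : A^kx\ge b^k\}$, $A^k\in\mathbb{Q}^{m\times n}$, $b^k\in\mathbb{Q}^m$, and $\mathcal{P}_I^k=\{x\in \mathcal{P}^k : x_j\in\mathbb{Z}\ \forall j\in\mathcal{I}\}$. Standing assumption: for every $k\in\mathcal{K}$ the constraints $A^kx\ge b^k$ include nonnegative lower and upper bounds on all variables; in particular $\mathcal{P}^k\subseteq\mathbb{R}^n_{\ge 0}$ and $\mathcal{P}^k$ is bounded. Disjunctions. $\{\mathcal{X}^t\}_{t\in\mathcal{T}}$ is a collection indexed by a finite nonempty set $\mathcal{T}$, with $\mathcal{X}^t=\{x\in\mathbb{R}^n : D^tx\ge D^t_0\}$, $D^t\in\mathbb{Q}^{q_t\times n}$, $D_0^t\in\mathbb{Q}^{q_t}$ (these sets are hyperrectangles obtained by restricting bounds on one or more variables), valid for the instances in the sense that $\mathcal{P}_I^k\subseteq\bigcup_{t\in\mathcal{T}}\mathcal{X}^t$ for all $k\in\mathcal{K}$. The description $(D^t,D^t_0)$ does not depend on the instance. For $k\in\mathcal{K}$, $t\in\mathcal{T}$ put $$A^{kt}=\begin{bmatrix}A^k\\ D^t\end{bmatrix},\quad b^{kt}=\begin{bmatrix}b^k\\ D^t_0\end{bmatrix},\quad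 \mathcal{Q}^{kt}=\mathcal{P}^k\cap \mathcal{X}^t=\{x\in\mathbb{R}^n: A^{kt}x\ge b^{kt}\}.$$ Let $\mathcal{T}^k=\{t\in\mathcal{T}:\mathcal{Q}^{kt}\neq\emptyset\}$. Farkas certificates. A Farkas certificate is a family $\{v^t\}_{t\in\mathcal{T}}$ of nonnegative row vectors $v^t\in\mathbb{R}_{\ge 0}^{1\times(m+q_t)}$. It is induced by (IP-$k$) and $\{\mathcal{X}^t\}_{t\in\mathcal{T}}$ if $v^{t_1}A^{kt_1}=v^{t_2}A^{kt_2}$ for all $t_1,t_2\in\mathcal{T}^k$; by convention $v^t=0$ for $t\in\mathcal{T}\setminus\mathcal{T}^k$ (terms infeasible for the inducing instance $k$). Bases. A basis $\mathcal{A}^t\subseteq[m+q_t]$ is a set of indices of $n$ linearly independent constraints (rows of $A^{kt}$). It determines $v^t$ if $\{i\in[m+q_t]: v^t_i>0\}\subseteq\mathcal{A}^t$. It is feasible for $\mathcal{Q}^{\ell t}$ if the rows of $A^{\ell t}$ indexed by $\mathcal{A}^t$ form an invertible matrix $A^{\ell t}_{\mathcal{A}^t}$ and the basic solution $(A^{\ell t}_{\mathcal{A}^t})^{-1}b^{\ell t}_{\mathcal{A}^t}$ lies in $\mathcal{Q}^{\ell t}$. Support. A pair $(\alpha,\beta)\in\mathbb{R}^n\times\mathbb{R}$ is valid for a set $S$ if $\alpha^Tx\ge\beta$ for all $x\in S$; it supports a polyhedron $\mathcal{P}$ if it is valid for $\mathcal{P}$ and there exists $x\in\mathcal{P}$ with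 $\alpha^Tx=\beta$. Strong PDI Generator. Notation: for a nonempty $S\subseteq\mathcal{T}$ and nonnegative row vectors $\{w^t\}_{t\in S}$, let $\mathrm{PDI}_\ell(S,w)$ be the pair $(\alpha,\beta)$ with $\alpha_j=\max_{t\in S}\{w^tA^{\ell t}_{\cdot j}\}$ for $j\in[n]$ and $\beta=\min_{t\in S}\{w^tb^{\ell t}\}$, where $A^{\ell t}_{\cdot j}$ is the $j$-th column of $A^{\ell t}$. For $\alpha\in\mathbb{R}^n$ let $\mathcal{D}^{\ell t}(\alpha)=\{v\in\mathbb{R}^{1\times(m+q_t)}: vA^{\ell t}=\alpha^T,\ v\ge 0\}$. The algorithm is: (1) Set $\mathcal{T}_f=\{t\in\mathcal{T}: v^t\ne 0 \text{ and } \mathcal{A}^t \text{ is feasible for } \mathcal{Q}^{\ell t}\}$. (2) Set $\bar v^t=v^t$ for all $t\in\mathcal{T}$. (3) Set $(\alpha,\beta)=\mathrm{PDI}_\ell(\mathcal{T}_f,v)$. (4) For every $t\in\mathcal{T}^\ell$ such that $A^{kt}\neq A^{\ell t}$ or $t\notin\mathcal{T}_f$, replace $\bar v^t$ by an element of $\arg\max\{v b^{\ell t}: v\in\mathcal{D}^{\ell t}(\alpha)\}$. (5) Set $(\alpha,\bar\beta)=\mathrm{PDI}_\ell(\mathcal{T}^\ell,\bar v)$ and return $(\alpha,\bar\beta)$. *)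

theory Defs
  imports "HOL-Analysis.Analysis"
begin

text \<open>
  A matrix with \<open>n\<close> columns is the list of its rows, each a vector in \<^typ>\<open>real^'n\<close> (so that
  \<open>n = CARD('n)\<close>); a vector indexed by the rows is a list of reals. Stacking of matrices is thus
  list concatenation, and row indices are 0-based.
\<close>

definition polyhedron_of :: "(real^'n) list \<Rightarrow> real list \<Rightarrow> (real^'n) set" where
  "polyhedron_of A b = {x. \<forall>i<length A. A ! i \<bullet> x \<ge> b ! i}"

definition row_vec_mult :: "real list \<Rightarrow> (real^'n) list \<Rightarrow> real^'n" where
  "row_vec_mult v A = (\<Sum>i<length A. (v ! i) *\<^sub>R (A ! i))"

definition row_vec_dot :: "real list \<Rightarrow> real list \<Rightarrow> real" where
  "row_vec_dot v b = (\<Sum>i<length b. v ! i * b ! i)"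

definition nonneg_row_vec :: "nat \<Rightarrow> real list \<Rightarrow> bool" where
  "nonneg_row_vec N v \<longleftrightarrow> length v = N \<and> (\<forall>i<N. v ! i \<ge> 0)"

definition rational_system :: "nat \<Rightarrow> (real^'n) list \<Rightarrow> real list \<Rightarrow> bool" where
  "rational_system N A b \<longleftrightarrow>
     length A = N \<and> length b = N \<and> (\<forall>i<N. (\<forall>j. A ! i $ j \<in> \<rat>) \<and> b ! i \<in> \<rat>)"

record ('n::finite) milp =
  cost :: "real^'n"
  lhs :: "(real^'n) list"
  rhs :: "real list"

definition lp_feasible :: "'n::finite milp \<Rightarrow> (real^'n) set" where
  "lp_feasible P = polyhedron_of (lhs P) (rhs P)"

definition mip_feasible :: "'n::finite set \<Rightarrow> 'n milp \<Rightarrow> (real^'n) set" where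
  "mip_feasible I P = {x \<in> lp_feasible P. \<forall>j\<in>I. x $ j \<in> \<int>}"

text \<open>
  For every variable, some row is a positive multiple of \<open>x\<^sub>j \<ge> l\<close> and some row is a positive
  multiple of \<open>- x\<^sub>j \<ge> - u\<close>, where \<open>l, u \<ge> 0\<close>.
\<close>
definition includes_nonneg_bounds :: "'n::finite milp \<Rightarrow> bool" where
  "includes_nonneg_bounds P \<longleftrightarrow>
     (\<forall>j. (\<exists>i<length (lhs P). \<exists>s>0. \<exists>l\<ge>0. lhs P ! i = s *\<^sub>R axis j 1 \<and> rhs P ! i = s * l) \<and>
          (\<exists>i<length (lhs P). \<exists>s>0. \<exists>u\<ge>0. lhs P ! i = s *\<^sub>R (- axis j 1) \<and> rhs P ! i = s * (- u)))"

definition milp_family :: "nat \<Rightarrow> 'k set \<Rightarrow> ('k \<Rightarrow> 'n::finite milp) \<Rightarrow> bool" where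
  "milp_family m K IP \<longleftrightarrow>
     (\<forall>k\<in>K. rational_system m (lhs (IP k)) (rhs (IP k)) \<and> includes_nonneg_bounds (IP k))"

text \<open>Bounds range over the extended reals: a variable may be unbounded in a term.\<close>
definition hyperrectangle :: "(real^'n) set \<Rightarrow> bool" where
  "hyperrectangle X \<longleftrightarrow>
     (\<exists>lo hi :: 'n \<Rightarrow> ereal. X = {x. \<forall>j. lo j \<le> ereal (x $ j) \<and> ereal (x $ j) \<le> hi j})"

definition valid_disjunction ::
  "'n::finite set \<Rightarrow> 'k set \<Rightarrow> ('k \<Rightarrow> 'n milp) \<Rightarrow> 't set \<Rightarrow> ('t \<Rightarrow> nat) \<Rightarrow>
   ('t \<Rightarrow> (real^'n) list) \<Rightarrow> ('t \<Rightarrow> real list) \<Rightarrow> bool" where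
  "valid_disjunction I K IP T q D D0 \<longleftrightarrow>
     finite T \<and> T \<noteq> {} \<and>
     (\<forall>t\<in>T. rational_system (q t) (D t) (D0 t) \<and> hyperrectangle (polyhedron_of (D t) (D0 t))) \<and>
     (\<forall>k\<in>K. mip_feasible I (IP k) \<subseteq> (\<Union>t\<in>T. polyhedron_of (D t) (D0 t)))"

text \<open>
  From here on, \<open>P\<close> is a single instance, and \<open>A\<^sup>k\<^sup>t\<close>, \<open>b\<^sup>k\<^sup>t\<close>, \<open>Q\<^sup>k\<^sup>t\<close>, \<open>T\<^sup>k\<close> are obtained for
  \<open>P = IP k\<close>.
\<close>

definition term_lhs :: "('t \<Rightarrow> (real^'n) list) \<Rightarrow> 'n::finite milp \<Rightarrow> 't \<Rightarrow> (real^'n) list" where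
  "term_lhs D P t = lhs P @ D t"

definition term_rhs :: "('t \<Rightarrow> real list) \<Rightarrow> 'n::finite milp \<Rightarrow> 't \<Rightarrow> real list" where
  "term_rhs D0 P t = rhs P @ D0 t"

definition term_polyhedron ::
  "('t \<Rightarrow> (real^'n) list) \<Rightarrow> ('t \<Rightarrow> real list) \<Rightarrow> 'n::finite milp \<Rightarrow> 't \<Rightarrow> (real^'n) set" where
  "term_polyhedron D D0 P t = lp_feasible P \<inter> polyhedron_of (D t) (D0 t)"

definition feasible_terms ::
  "'t set \<Rightarrow> ('t \<Rightarrow> (real^'n) list) \<Rightarrow> ('t \<Rightarrow> real list) \<Rightarrow> 'n::finite milp \<Rightarrow> 't set" where
  "feasible_terms T D D0 P = {t \<in> T. term_polyhedron D D0 P t \<noteq> {}}"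

definition farkas_certificate :: "nat \<Rightarrow> 't set \<Rightarrow> ('t \<Rightarrow> nat) \<Rightarrow> ('t \<Rightarrow> real list) \<Rightarrow> bool" where
  "farkas_certificate m T q v \<longleftrightarrow> (\<forall>t\<in>T. nonneg_row_vec (m + q t) (v t))"

definition zero_row_vec :: "real list \<Rightarrow> bool" where
  "zero_row_vec v \<longleftrightarrow> (\<forall>i<length v. v ! i = 0)"

definition induced_by ::
  "'t set \<Rightarrow> ('t \<Rightarrow> (real^'n) list) \<Rightarrow> ('t \<Rightarrow> real list) \<Rightarrow> 'n::finite milp \<Rightarrow>
   ('t \<Rightarrow> real list) \<Rightarrow> bool" where
  "induced_by T D D0 P v \<longleftrightarrow>
     (\<forall>t1\<in>feasible_terms T D D0 P. \<forall>t2\<in>feasible_terms T D D0 P.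
        row_vec_mult (v t1) (term_lhs D P t1) = row_vec_mult (v t2) (term_lhs D P t2)) \<and>
     (\<forall>t\<in>T - feasible_terms T D D0 P. zero_row_vec (v t))"

text \<open>
  Injectivity is required because \<^const>\<open>independent\<close> is a property of the set of rows and would
  not notice a repeated row.
\<close>
definition is_basis :: "(real^'n) list \<Rightarrow> nat set \<Rightarrow> bool" where
  "is_basis A B \<longleftrightarrow>
     B \<subseteq> {..<length A} \<and> card B = CARD('n) \<and> inj_on ((!) A) B \<and> independent ((!) A ` B)"

definition determines :: "nat set \<Rightarrow> real list \<Rightarrow> bool" where
  "determines B v \<longleftrightarrow> {i. i < length v \<and> v ! i > 0} \<subseteq> B"

text \<open>
  \<open>f\<close> lists the rows of the basis matrix in some order, which affects neither invertibility nor
  the basic solution.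
\<close>
definition basis_feasible :: "(real^'n) list \<Rightarrow> real list \<Rightarrow> nat set \<Rightarrow> bool" where
  "basis_feasible A b B \<longleftrightarrow>
     (\<exists>f :: 'n \<Rightarrow> nat. bij_betw f UNIV B \<and>
        (let M = (\<chi> i. A ! f i) :: real^'n^'n in
           invertible M \<and> matrix_inv M *v (\<chi> i. b ! f i) \<in> polyhedron_of A b))"

definition valid_for :: "real^'n \<Rightarrow> real \<Rightarrow> (real^'n) set \<Rightarrow> bool" where
  "valid_for \<alpha> \<beta> S \<longleftrightarrow> (\<forall>x\<in>S. \<alpha> \<bullet> x \<ge> \<beta>)"

definition supports :: "real^'n \<Rightarrow> real \<Rightarrow> (real^'n) set \<Rightarrow> bool" where
  "supports \<alpha> \<beta> S \<longleftrightarrow> valid_for \<alpha> \<beta> S \<and> (\<exists>x\<in>S. \<alpha> \<bullet> x = \<beta>)"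

text \<open>Meaningful only for finite nonempty \<open>S\<close>.\<close>
definition PDI ::
  "('t \<Rightarrow> (real^'n) list) \<Rightarrow> ('t \<Rightarrow> real list) \<Rightarrow> 'n::finite milp \<Rightarrow>
   't set \<Rightarrow> ('t \<Rightarrow> real list) \<Rightarrow> (real^'n) \<times> real" where
  "PDI D D0 P S w =
     ((\<chi> j. Max ((\<lambda>t. row_vec_mult (w t) (term_lhs D P t) $ j) ` S)),
      Min ((\<lambda>t. row_vec_dot (w t) (term_rhs D0 P t)) ` S))"

definition dual_feasible ::
  "('t \<Rightarrow> (real^'n) list) \<Rightarrow> 'n::finite milp \<Rightarrow> 't \<Rightarrow> real^'n \<Rightarrow> real list set" where
  "dual_feasible D P t \<alpha> =
     {v. nonneg_row_vec (length (term_lhs D P t)) v \<and> row_vec_mult v (term_lhs D P t) = \<alpha>}"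

definition usable_terms ::
  "'t set \<Rightarrow> ('t \<Rightarrow> (real^'n) list) \<Rightarrow> ('t \<Rightarrow> real list) \<Rightarrow> 'n::finite milp \<Rightarrow>
   ('t \<Rightarrow> real list) \<Rightarrow> ('t \<Rightarrow> nat set) \<Rightarrow> 't set" where
  "usable_terms T D D0 P v B =
     {t \<in> T. \<not> zero_row_vec (v t) \<and> basis_feasible (term_lhs D P t) (term_rhs D0 P t) (B t)}"

text \<open>
  The Strong PDI Generator is nondeterministic in the choice of dual optimal solutions, so it is
  rendered as the relation between its input and its possible outputs; \<open>P\<close> is the instance that
  induced the certificate \<open>v\<close>, and \<open>P'\<close> is the instance for which the inequality is generated.
\<close>
definition strong_PDI_output ::
  "'t set \<Rightarrow> ('t \<Rightarrow> (real^'n) list) \<Rightarrow> ('t \<Rightarrow> real list) \<Rightarrow> 'n::finite milp \<Rightarrow> 'n milp \<Rightarrow>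
   ('t \<Rightarrow> real list) \<Rightarrow> ('t \<Rightarrow> nat set) \<Rightarrow> (real^'n) \<times> real \<Rightarrow> bool" where
  "strong_PDI_output T D D0 P P' v B out \<longleftrightarrow>
     (let Tf = usable_terms T D D0 P' v B;
          (\<alpha>, \<beta>) = PDI D D0 P' Tf v
      in \<exists>vbar.
           (\<forall>t\<in>T.
              if t \<in> feasible_terms T D D0 P' \<and> (term_lhs D P t \<noteq> term_lhs D P' t \<or> t \<notin> Tf)
              then is_arg_max (\<lambda>u. row_vec_dot u (term_rhs D0 P' t))
                     (\<lambda>u. u \<in> dual_feasible D P' t \<alpha>) (vbar t)
              else vbar t = v t) \<and>
           out = PDI D D0 P' (feasible_terms T D D0 P') vbar)"

end

theory Submission
  imports Defs
begin

text \<open>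
  Step (5) reproduces the vector \<open>\<alpha>\<close> of step (3), because every term in use satisfies
  \<open>vbar\<^sup>t A\<^sup>l\<^sup>t = \<alpha>\<close>: a recomputed multiplier does so by dual feasibility, and a multiplier is kept only
  if \<open>A\<^sup>k\<^sup>t = A\<^sup>l\<^sup>t\<close>, that is \<open>A\<^sup>k = A\<^sup>l\<close>, in which case all terms used in step (3) produce the same
  vector, since the certificate is induced by \<open>k\<close> and a nonzero \<open>v\<^sup>t\<close> belongs to a term feasible
  for \<open>k\<close>. Weak duality then gives validity. For the term attaining the minimum \<open>\<beta>\<close> there is a
  point of equality: the basic solution for a kept multiplier (complementary slackness), and a
  minimiser of \<open>\<alpha> \<bullet> x\<close> for a recomputed one (strong duality; the term is compact).
\<close>

section \<open>Finitely generated cones and linear programming duality\<close>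

lemma convex_cone_hull_image_subset:
  fixes f :: "'a \<Rightarrow> 'b::real_vector"
  assumes "finite J" "x \<in> convex_cone hull (f ` J)"
  obtains u where "\<And>i. i \<in> J \<Longrightarrow> 0 \<le> u i" "x = (\<Sum>i\<in>J. u i *\<^sub>R f i)"
proof -
  \<comment> \<open>The set \<open>?C\<close> is a convex cone containing every generator, so it
    contains the hull. Coefficients are attached to indices rather than to vectors, so repeated
    generators keep separate multipliers.\<close>
  let ?C = "{x. \<exists>u. (\<forall>i\<in>J. 0 \<le> u i) \<and> x = (\<Sum>i\<in>J. u i *\<^sub>R f i)}"
  have "convex_cone ?C"
    unfolding convex_cone_iff
  proof (intro conjI ballI allI impI)
    show "0 \<in> ?C" by (auto intro!: exI[of _ "\<lambda>_. 0"])
    fix x assume "x \<in> ?C"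
    then obtain u where u: "\<forall>i\<in>J. 0 \<le> u i" "x = (\<Sum>i\<in>J. u i *\<^sub>R f i)" by blast
    show "c *\<^sub>R x \<in> ?C" if "c \<ge> 0" for c
      using u that by (auto intro!: exI[of _ "\<lambda>i. c * u i"] simp: scaleR_sum_right)
    fix y assume "y \<in> ?C"
    then obtain w where "\<forall>i\<in>J. 0 \<le> w i" "y = (\<Sum>i\<in>J. w i *\<^sub>R f i)" by blast
    with u show "x + y \<in> ?C"
      by (auto intro!: exI[of _ "\<lambda>i. u i + w i"] simp: scaleR_add_left sum.distrib)
  qed
  moreover have "f ` J \<subseteq> ?C"
  proof clarify
    fix j assume "j \<in> J"
    with \<open>finite J\<close> have "f j = (\<Sum>i\<in>J. (if i = j then 1 else 0) *\<^sub>R f i)"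
      by (simp add: if_distrib[of "\<lambda>c. c *\<^sub>R _"] cong: if_cong)
    then show "\<exists>u. (\<forall>i\<in>J. 0 \<le> u i) \<and> f j = (\<Sum>i\<in>J. u i *\<^sub>R f i)"
      by (intro exI[of _ "\<lambda>i. if i = j then 1 else 0"]) auto
  qed
  ultimately have "x \<in> ?C" using assms(2) hull_minimal by blast
  with that show thesis by blast
qed

lemma row_vec_mult_inner:
  "row_vec_mult v A \<bullet> x = (\<Sum>i<length A. v ! i * (A ! i \<bullet> x))"
  by (simp add: row_vec_mult_def inner_sum_left)

lemma weak_duality:
  assumes "length A = length b" "nonneg_row_vec (length A) u" "x \<in> polyhedron_of A b"
  shows "row_vec_dot u b \<le> row_vec_mult u A \<bullet> x"
  unfolding row_vec_mult_inner row_vec_dot_def assms(1)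
  using assms by (intro sum_mono mult_left_mono) (auto simp: nonneg_row_vec_def polyhedron_of_def)

text \<open>Membership of \<open>(c, c \<bullet> x0)\<close> in a finitely generated cone encodes a
  dual solution of sufficient value. This cone is closed, so non-membership yields a separating
  functional, from which a feasible point with a value below \<open>c \<bullet> x0\<close> is
  built.\<close>

lemma strong_duality:
  fixes A :: "(real^'n) list"
  assumes len: "length A = length b"
    and x0: "x0 \<in> polyhedron_of A b"
    and min: "\<And>x. x \<in> polyhedron_of A b \<Longrightarrow> c \<bullet> x0 \<le> c \<bullet> x"
  obtains u where "nonneg_row_vec (length A) u" "row_vec_mult u A = c" "c \<bullet> x0 \<le> row_vec_dot u b"
proof -
  let ?N = "length A"
  \<comment> \<open>The generator \<open>(0, -1)\<close> allows the right-hand side to be weakened.\<close>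
  define g where "g i = (if i < ?N then (A ! i, b ! i) else (0, -1))" for i
  define C where "C = convex_cone hull (g ` {..?N})"
  have cone: "convex_cone C" by (simp add: C_def convex_cone_convex_cone_hull)
  have "(c, c \<bullet> x0) \<in> C"
  proof (rule ccontr)
    assume "(c, c \<bullet> x0) \<notin> C"
    moreover have "convex C" "closed C"
      by (auto simp: C_def convex_convex_cone_hull intro: closed_convex_cone_hull)
    ultimately obtain p r where lt: "p \<bullet> (c, c \<bullet> x0) < r" and gt: "\<And>y. y \<in> C \<Longrightarrow> r < p \<bullet> y"
      using separating_hyperplane_closed_point[of C "(c, c \<bullet> x0)"] by blast
    have "r < 0" using gt[OF convex_cone_contains_0[OF cone]] by simp
    \<comment> \<open>A negative value on the cone could be scaled to equal exactly
      \<open>r\<close>, contradicting the strict bound \<open>gt\<close>.\<close>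
    have nonneg: "0 \<le> p \<bullet> y" if "y \<in> C" for y
    proof (rule ccontr)
      assume neg: "\<not> 0 \<le> p \<bullet> y"
      then have "(r / (p \<bullet> y)) *\<^sub>R y \<in> C"
        using \<open>r < 0\<close> that by (intro convex_cone_scaleR[OF cone]) (auto intro: divide_nonpos_nonpos)
      from gt[OF this] neg show False by simp
    qed
    obtain y z where p: "p = (y, z)" by fastforce
    have sep: "y \<bullet> c + z * (c \<bullet> x0) < 0" using lt \<open>r < 0\<close> by (simp add: p)
    have gen: "0 \<le> p \<bullet> g i" if "i \<le> ?N" for i
      using that by (auto simp: C_def intro!: nonneg hull_inc)
    have z: "z \<le> 0" using gen[of ?N] by (simp add: p g_def)
    have rows: "0 \<le> A ! i \<bullet> y + z * b ! i" if "i < ?N" for i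
      using gen[of i] that by (simp add: p g_def inner_commute)
    show False
    proof (cases "z = 0")
      case True
      \<comment> \<open>Here \<open>y\<close> is a recession direction along which \<open>c\<close>
        strictly decreases.\<close>
      then have "x0 + y \<in> polyhedron_of A b"
        using x0 rows by (fastforce simp: polyhedron_of_def inner_add_right)
      from min[OF this] sep True show False by (simp add: inner_add_right inner_commute)
    next
      case False
      with z have "z < 0" by simp
      \<comment> \<open>Dividing by \<open>- z\<close> turns \<open>rows\<close> into feasibility
        and \<open>sep\<close> into a value below the minimum.\<close>
      have "(1 / - z) *\<^sub>R y \<in> polyhedron_of A b"
        using rows \<open>z < 0\<close> by (fastforce simp: polyhedron_of_def field_simps)
      from min[OF this] sep \<open>z < 0\<close> show False
        by (simp add: field_simps inner_commute)
    qed
  qed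
  then obtain u where u: "\<And>i. i \<in> {..?N} \<Longrightarrow> 0 \<le> u i"
    and eq: "(c, c \<bullet> x0) = (\<Sum>i\<in>{..?N}. u i *\<^sub>R g i)"
    unfolding C_def by (rule convex_cone_hull_image_subset[rotated]) auto
  have g: "(\<Sum>i\<in>{..?N}. u i *\<^sub>R g i) = (\<Sum>i<?N. u i *\<^sub>R (A ! i, b ! i)) + u ?N *\<^sub>R (0, -1)"
    by (simp add: lessThan_Suc_atMost[symmetric] g_def)
  have "c = (\<Sum>i<?N. u i *\<^sub>R A ! i)"
    using arg_cong[OF eq[unfolded g], of fst] by (simp add: fst_sum)
  moreover have "c \<bullet> x0 = (\<Sum>i<?N. u i * b ! i) - u ?N"
    using arg_cong[OF eq[unfolded g], of snd] by (simp add: snd_sum)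
  \<comment> \<open>The coefficient \<open>u ?N\<close> of \<open>(0, -1)\<close> is left out of the
    list; its nonnegativity is what gives the inequality for the dual value.\<close>
  ultimately show thesis
    using u[of ?N] u len
    by (intro that[of "map u [0..<?N]"])
      (auto simp: nonneg_row_vec_def row_vec_mult_def row_vec_dot_def)
qed

text \<open>Complementary slackness: rows in \<open>B\<close> are tight at the basic solution, and
  rows outside \<open>B\<close> have multiplier zero, so the two sides agree summand by
  summand.\<close>

lemma basic_solution_attains:
  fixes A :: "(real^'n) list"
  assumes len: "length A = length b"
    and nonneg: "nonneg_row_vec (length A) u"
    and det: "determines B u"
    and feas: "basis_feasible A b B"
  obtains x where "x \<in> polyhedron_of A b" "row_vec_mult u A \<bullet> x = row_vec_dot u b"
proof -
  from feas obtain f :: "'n \<Rightarrow> nat" where f: "bij_betw f UNIV B"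
    and inv: "invertible (\<chi> i. A ! f i :: real^'n^'n)"
    and x: "matrix_inv (\<chi> i. A ! f i :: real^'n^'n) *v (\<chi> i. b ! f i) \<in> polyhedron_of A b"
    by (auto simp: basis_feasible_def Let_def)
  define M where "M = (\<chi> i. A ! f i :: real^'n^'n)"
  define x where "x = matrix_inv M *v (\<chi> i. b ! f i)"
  have "M ** matrix_inv M = mat 1"
    using inv unfolding M_def[symmetric] invertible_def matrix_inv_def by (metis (mono_tags, lifting) someI_ex)
  then have Mx: "M *v x = (\<chi> i. b ! f i)"
    by (simp add: x_def matrix_vector_mul_assoc)
  have tight: "A ! i \<bullet> x = b ! i" if "i \<in> B" for i
  proof -
    have "i \<in> range f" using f that by (simp add: bij_betw_def)
    then obtain j where j: "i = f j" by blast
    have "(M *v x) $ j = A ! f j \<bullet> x"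
      by (simp add: M_def matrix_vector_mult_def inner_vec_def)
    with Mx j show ?thesis by simp
  qed
  have "u ! i * (A ! i \<bullet> x) = u ! i * b ! i" if "i < length A" for i
    using that nonneg det tight[of i] unfolding nonneg_row_vec_def determines_def by force
  then have "row_vec_mult u A \<bullet> x = row_vec_dot u b"
    unfolding row_vec_mult_inner row_vec_dot_def len[symmetric] by (intro sum.cong) auto
  with x that show thesis by (simp add: x_def M_def)
qed

section \<open>Closedness, boundedness and stacking of polyhedra\<close>

lemma closed_polyhedron_of: "closed (polyhedron_of A b)"
proof -
  have "polyhedron_of A b = (\<Inter>i<length A. {x. A ! i \<bullet> x \<ge> b ! i})"
    by (auto simp: polyhedron_of_def)
  then show ?thesis by (auto intro!: closed_INT closed_halfspace_ge)
qed

text \<open>The positive scalings of the bound rows cancel, leaving a box. This provides the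
  compactness by which \<open>\<alpha> \<bullet> x\<close> attains its minimum on a term.\<close>

lemma bounded_lp_feasible:
  assumes "includes_nonneg_bounds P"
  shows "bounded (lp_feasible P)"
proof -
  have "\<exists>l u. \<forall>x\<in>lp_feasible P. l \<le> x $ j \<and> x $ j \<le> u" for j
  proof -
    obtain i s l i' s' u where "i < length (lhs P)" "s > 0" "lhs P ! i = s *\<^sub>R axis j 1"
        "rhs P ! i = s * l" "i' < length (lhs P)" "s' > 0"
        "lhs P ! i' = s' *\<^sub>R (- axis j 1)" "rhs P ! i' = s' * (- u)"
      using assms unfolding includes_nonneg_bounds_def by metis
    then have "l \<le> x $ j \<and> x $ j \<le> u" if "x \<in> lp_feasible P" for x
      using that unfolding lp_feasible_def polyhedron_of_def
      by (fastforce simp: inner_axis')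
    then show ?thesis by blast
  qed
  then obtain l u where "\<forall>j. \<forall>x\<in>lp_feasible P. l j \<le> x $ j \<and> x $ j \<le> u j" by metis
  then have "lp_feasible P \<subseteq> cbox (\<chi> j. l j) (\<chi> j. u j)"
    by (auto simp: mem_box_cart)
  then show ?thesis using bounded_subset bounded_cbox by blast
qed

lemma polyhedron_of_append:
  assumes "length A = length b"
  shows "polyhedron_of (A @ A') (b @ b') = polyhedron_of A b \<inter> polyhedron_of A' b'"
proof -
  have "(\<forall>i<length A + length A'. P i) \<longleftrightarrow>
      (\<forall>i<length A. P i) \<and> (\<forall>i<length A'. P (length A + i))" for P
  proof (intro iffI allI impI)
    fix i
    assume "(\<forall>i<length A. P i) \<and> (\<forall>i<length A'. P (length A + i))" "i < length A + length A'"
    then show "P i"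
      by (cases "i < length A") (auto dest: spec[of _ "i - length A"])
  qed auto
  then show ?thesis
    using assms by (auto simp: polyhedron_of_def nth_append)
qed

text \<open>Each maximum is over a singleton. This serves twice: for \<open>v\<close> on
  \<open>Tf\<close> in step (3) when a multiplier is kept, and for \<open>vbar\<close> on
  \<open>Tl\<close> in step (5).\<close>

lemma PDI_fst_eq:
  assumes "finite S" "S \<noteq> {}" "\<And>t. t \<in> S \<Longrightarrow> row_vec_mult (w t) (term_lhs D P t) = a"
  shows "fst (PDI D D0 P S w) = a"
proof -
  have "(\<lambda>t. row_vec_mult (w t) (term_lhs D P t) $ j) ` S = {a $ j}" for j
    using assms(2,3) by (auto simp: image_iff)
  then show ?thesis by (simp add: PDI_def vec_eq_iff)
qed

theorem theorem2:
  fixes I :: "'n::finite set"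
    and m :: nat
    and K :: "'k set"
    and IP :: "'k \<Rightarrow> 'n milp"
    and T :: "'t set"
    and q :: "'t \<Rightarrow> nat"
    and D :: "'t \<Rightarrow> (real^'n) list"
    and D0 :: "'t \<Rightarrow> real list"
    and v :: "'t \<Rightarrow> real list"
    and B :: "'t \<Rightarrow> nat set"
    and k l :: 'k
    and \<alpha> :: "real^'n"
    and \<beta> :: real
  assumes "milp_family m K IP"
    and "k \<in> K" and "l \<in> K"
    and "valid_disjunction I K IP T q D D0"
    and "farkas_certificate m T q v"
    and "induced_by T D D0 (IP k) v"
    and "\<forall>t\<in>T. is_basis (term_lhs D (IP k) t) (B t) \<and> determines (B t) (v t)"
    and "\<exists>t\<in>T. basis_feasible (term_lhs D (IP l) t) (term_rhs D0 (IP l) t) (B t) \<and>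
               \<not> zero_row_vec (v t)"
    and "strong_PDI_output T D D0 (IP k) (IP l) v B (\<alpha>, \<beta>)"
  shows "supports \<alpha> \<beta> (closure (convex hull (\<Union>t\<in>T. term_polyhedron D D0 (IP l) t)))"
proof -
  let ?A = "\<lambda>t. term_lhs D (IP l) t" and ?b = "\<lambda>t. term_rhs D0 (IP l) t"
  let ?Q = "\<lambda>t. term_polyhedron D D0 (IP l) t"
  define Tl where "Tl = feasible_terms T D D0 (IP l)"
  define Tf where "Tf = usable_terms T D D0 (IP l) v B"
  \<comment> \<open>The vector of step (3), kept apart from the returned \<open>\<alpha>\<close>
    until the two are shown equal.\<close>
  define \<alpha>0 where "\<alpha>0 = fst (PDI D D0 (IP l) Tf v)"
  have lenP: "length (lhs (IP k)) = m" "length (lhs (IP l)) = m" "length (rhs (IP l)) = m"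
    and bounds: "includes_nonneg_bounds (IP l)"
    using assms(1-3) by (auto simp: milp_family_def rational_system_def)
  have lenA: "length (?A t) = m + q t" "length (?b t) = m + q t" if "t \<in> T" for t
    using assms(4) that lenP
    by (auto simp: valid_disjunction_def rational_system_def term_lhs_def term_rhs_def)
  have Q: "?Q t = polyhedron_of (?A t) (?b t)" for t
    using lenP by (simp add: term_polyhedron_def term_lhs_def term_rhs_def lp_feasible_def polyhedron_of_append)
  have "finite T" using assms(4) by (simp add: valid_disjunction_def)
  have "Tf \<noteq> {}" using assms(8) by (auto simp: Tf_def usable_terms_def)
  have "Tl \<subseteq> T" by (auto simp: Tl_def feasible_terms_def)
  \<comment> \<open>The basic solution of a feasible basis is a point of the term.\<close>
  have "Tf \<subseteq> Tl"
    by (auto simp: Tf_def usable_terms_def Tl_def feasible_terms_def basis_feasible_def Let_def Q)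
  have "finite Tl" using \<open>Tl \<subseteq> T\<close> \<open>finite T\<close> by (rule finite_subset)
  have "finite Tf" using \<open>Tf \<subseteq> Tl\<close> \<open>finite Tl\<close> by (rule finite_subset)
  have "Tl \<noteq> {}" using \<open>Tf \<noteq> {}\<close> \<open>Tf \<subseteq> Tl\<close> by blast
  have Tf_k: "t \<in> feasible_terms T D D0 (IP k)" if "t \<in> Tf" for t
    using that assms(6) by (auto simp: Tf_def usable_terms_def induced_by_def)

  obtain vbar where recomputed: "\<And>t. t \<in> Tl \<Longrightarrow> term_lhs D (IP k) t \<noteq> ?A t \<or> t \<notin> Tf \<Longrightarrow>
        is_arg_max (\<lambda>u. row_vec_dot u (?b t)) (\<lambda>u. u \<in> dual_feasible D (IP l) t \<alpha>0) (vbar t)"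
    and kept: "\<And>t. t \<in> Tl \<Longrightarrow> \<not> (term_lhs D (IP k) t \<noteq> ?A t \<or> t \<notin> Tf) \<Longrightarrow> vbar t = v t"
    and out: "(\<alpha>, \<beta>) = PDI D D0 (IP l) Tl vbar"
  proof -
    from assms(9) obtain vbar where vb: "\<forall>t\<in>T.
              if t \<in> Tl \<and> (term_lhs D (IP k) t \<noteq> ?A t \<or> t \<notin> Tf)
              then is_arg_max (\<lambda>u. row_vec_dot u (?b t))
                     (\<lambda>u. u \<in> dual_feasible D (IP l) t \<alpha>0) (vbar t)
              else vbar t = v t" and "(\<alpha>, \<beta>) = PDI D D0 (IP l) Tl vbar"
      unfolding strong_PDI_output_def Tf_def[symmetric] Tl_def[symmetric]
      by (simp only: Let_def case_prod_unfold \<alpha>0_def) blast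
    then show thesis
      using \<open>Tl \<subseteq> T\<close> by (intro that[of vbar]) (metis (no_types, lifting) subsetD)+
  qed

  \<comment> \<open>Dual feasibility of all multipliers used in step (5)\<close>
  have dual: "nonneg_row_vec (m + q t) (vbar t) \<and> row_vec_mult (vbar t) (?A t) = \<alpha>0"
    if t: "t \<in> Tl" for t
  proof (cases "term_lhs D (IP k) t \<noteq> ?A t \<or> t \<notin> Tf")
    case True
    then show ?thesis
      using recomputed[OF t True] lenA \<open>Tl \<subseteq> T\<close> t by (auto simp: is_arg_max_def dual_feasible_def)
  next
    case False
    \<comment> \<open>Both stacked matrices end in the same block \<open>D t\<close>, so equality at
      \<open>t\<close> cancels to equality of the instance matrices and then holds at every term
      \<open>s\<close>.\<close>
    then have same: "term_lhs D (IP k) s = ?A s" for s by (simp add: term_lhs_def)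
    have "row_vec_mult (v s) (?A s) = row_vec_mult (v t) (?A t)" if "s \<in> Tf" for s
      using assms(6) Tf_k[OF that] Tf_k[of t] False unfolding induced_by_def same by blast
    then have "\<alpha>0 = row_vec_mult (v t) (?A t)"
      unfolding \<alpha>0_def using \<open>finite Tf\<close> \<open>Tf \<noteq> {}\<close> by (intro PDI_fst_eq)
    then show ?thesis
      using kept[OF t False] assms(5) \<open>Tl \<subseteq> T\<close> t by (auto simp: farkas_certificate_def)
  qed
  then have "\<alpha> = \<alpha>0"
    using PDI_fst_eq[OF \<open>finite Tl\<close> \<open>Tl \<noteq> {}\<close>, of vbar D "IP l" \<alpha>0 D0] out by (metis fst_conv)
  have \<beta>: "\<beta> = Min ((\<lambda>t. row_vec_dot (vbar t) (?b t)) ` Tl)"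
    using out by (simp add: PDI_def)

  \<comment> \<open>Validity and tightness on a single term\<close>
  have weak: "row_vec_dot (vbar t) (?b t) \<le> \<alpha> \<bullet> x" if "t \<in> Tl" "x \<in> ?Q t" for t x
    using weak_duality[of "?A t" "?b t" "vbar t" x] dual[OF that(1)] that lenA \<open>Tl \<subseteq> T\<close> \<open>\<alpha> = \<alpha>0\<close>
    by (auto simp: Q)
  have attained: "\<exists>x\<in>?Q t. \<alpha> \<bullet> x = row_vec_dot (vbar t) (?b t)" if t: "t \<in> Tl" for t
  proof (cases "term_lhs D (IP k) t \<noteq> ?A t \<or> t \<notin> Tf")
    case True
    have "compact (?Q t)"
      using bounded_lp_feasible[OF bounds] closed_polyhedron_of[of "?A t" "?b t"]
      by (auto simp: compact_eq_bounded_closed term_polyhedron_def simp flip: Q intro: bounded_Int)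
    moreover have "?Q t \<noteq> {}" using t by (simp add: Tl_def feasible_terms_def)
    moreover have "continuous_on (?Q t) (\<lambda>x. \<alpha> \<bullet> x)" by (intro continuous_intros)
    ultimately have "\<exists>x0\<in>?Q t. \<forall>x\<in>?Q t. \<alpha> \<bullet> x0 \<le> \<alpha> \<bullet> x"
      by (rule continuous_attains_inf)
    then obtain x0 where x0: "x0 \<in> ?Q t" "\<And>x. x \<in> ?Q t \<Longrightarrow> \<alpha> \<bullet> x0 \<le> \<alpha> \<bullet> x" by blast
    have "length (?A t) = length (?b t)" using lenA t \<open>Tl \<subseteq> T\<close> by auto
    then obtain u where "nonneg_row_vec (length (?A t)) u" "row_vec_mult u (?A t) = \<alpha>"
        "\<alpha> \<bullet> x0 \<le> row_vec_dot u (?b t)"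
      using strong_duality[of "?A t" "?b t" x0 \<alpha>] x0 by (auto simp: Q)
    \<comment> \<open>As a dual maximiser, \<open>vbar t\<close> does at least as well as the
      \<open>u\<close> from strong duality.\<close>
    then have "\<alpha> \<bullet> x0 \<le> row_vec_dot (vbar t) (?b t)"
      using recomputed[OF t True] \<open>\<alpha> = \<alpha>0\<close> by (force simp: is_arg_max_def dual_feasible_def)
    with weak[OF t x0(1)] x0(1) show ?thesis by force
  next
    case False
    \<comment> \<open>Only the left-hand sides of the two instances are known to agree; tightness is
      therefore taken at the basic solution for the right-hand side of \<open>IP l\<close>.\<close>
    then have feas: "basis_feasible (?A t) (?b t) (B t)" by (simp add: Tf_def usable_terms_def)
    have "t \<in> T" using t \<open>Tl \<subseteq> T\<close> by blast
    then have "length (?A t) = length (?b t)" "nonneg_row_vec (length (?A t)) (vbar t)"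
        "determines (B t) (vbar t)"
      using dual[OF t] lenA[of t] assms(7) kept[OF t False] by auto
    then obtain x where "x \<in> polyhedron_of (?A t) (?b t)"
        "row_vec_mult (vbar t) (?A t) \<bullet> x = row_vec_dot (vbar t) (?b t)"
      using feas by (rule basic_solution_attains)
    then show ?thesis using dual[OF t] \<open>\<alpha> = \<alpha>0\<close> by (auto simp: Q)
  qed

  \<comment> \<open>From single terms to the closed convex hull\<close>
  let ?H = "closure (convex hull (\<Union>t\<in>T. ?Q t))"
  have "\<beta> \<le> \<alpha> \<bullet> x" if "t \<in> T" "x \<in> ?Q t" for t x
  proof -
    \<comment> \<open>A term outside \<open>Tl\<close> is empty, so the minimum over
      \<open>Tl\<close> bounds the whole union.\<close>
    have "t \<in> Tl" using that by (auto simp: Tl_def feasible_terms_def)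
    then have "\<beta> \<le> row_vec_dot (vbar t) (?b t)" using \<open>finite Tl\<close> by (simp add: \<beta>)
    also have "\<dots> \<le> \<alpha> \<bullet> x" using weak \<open>t \<in> Tl\<close> that by blast
    finally show ?thesis .
  qed
  then have "?H \<subseteq> {x. \<beta> \<le> \<alpha> \<bullet> x}"
    by (intro closure_minimal hull_minimal) (auto simp: convex_halfspace_ge closed_halfspace_ge)
  moreover have "\<exists>x\<in>?H. \<alpha> \<bullet> x = \<beta>"
  proof -
    have "\<beta> \<in> (\<lambda>t. row_vec_dot (vbar t) (?b t)) ` Tl"
      unfolding \<beta> using \<open>finite Tl\<close> \<open>Tl \<noteq> {}\<close> by (intro Min_in) auto
    then obtain t x where "t \<in> Tl" "x \<in> ?Q t" "\<alpha> \<bullet> x = \<beta>" using attained by blast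
    moreover have "x \<in> ?H"
      using \<open>t \<in> Tl\<close> \<open>x \<in> ?Q t\<close> \<open>Tl \<subseteq> T\<close> closure_subset hull_subset by (metis UN_I subsetD)
    ultimately show ?thesis by blast
  qed
  ultimately show ?thesis by (auto simp: supports_def valid_for_def)
qed

end
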